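(* Let $n\geq 4$ and let $\mathrm{GCB}(m)$, $m\geq 2$, be the lists of involutions of $\mathcal{S}_m^B$ defined below. If $\mathrm{GCB}(n-2)$ and $\mathrm{GCB}(n-1)$ each contain every involution of $\mathcal{S}^B_{n-2}$, resp. $\mathcal{S}^B_{n-1}$, exactly once and satisfy properties A1 and A2, then $\mathrm{GCB}(n)$ contains every involution of $\mathcal{S}_n^B$ exactly once, satisfies properties A1 and A2, and is cyclic (its first element is obtained from its last element in the manner described in A2).
   Context: $\overline{i}=-i$. $\mathcal{S}_n^B$ is the group of permutations $\pi$ of $\{\pm1,\dots,\pm n\}$ with $\pi(\overline i)=\overline{\pi(i)}$, written in one-line notation $\pi(1)\cdots\pi(n)$. An involution over an alphabet $N$ of positive integers is a permutation of $\pm N$ commuting with negation and squaring to the identity, written in one-line notation with positions indexed by $N$ increasingly. Cycle notation: for positive $i\neq j$, $(i\,j)$ swaps $i\leftrightarrow j$, $\overline i\leftrightarrow\overline j$; $(\overline i\,\overline j)$ swaps $i\leftrightarrow\overline j$, $\overline i\leftrightarrow j$; $(\overline j)$ swaps $j\leftrightarrow\overline j$; $\mathrm{id}$ is the identity. List operations for $L=(w_1,\dots,w_m)$ over $N$: $\overleftarrow L$ is the reversal; for $k\notin N$, $L\cdot k$ extends each $w_\ell$ to $\pm(N\cup\{k\})$ fixing $k$, and $L\cdot\overline{k}$ extends each $w_\ell$ by composing with $(\overline k)$; for $i,j\notin N$, $L\cdot(i\,j)$ and $L\cdot(\overline i\,\overline j)$ compose each $w_\ell$ with the disjoint transposition $(i\,j)$,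 resp. $(\overline i\,\overline j)$. For a bijection $F:[r]\to N$ written $F=F(1)\cdots F(r)$ and $w$ an involution over $[r]$, $w^F$ is the involution over $N$ with $w^F(F(i))=F(w(i))$, where $F(\overline j):=\overline{F(j)}$; $L^F=(w_1^F,\dots,w_m^F)$ and $\overleftarrow{L}^F$ is its reversal. The lists: $\mathrm{GCB}(2)=(\mathrm{id},(\overline1),(\overline1)(\overline2),(\overline2),(\overline1\,\overline2),(1\,2))$; $\mathrm{GCB}(3)=(\mathrm{id},(\overline1),(\overline1)(\overline2),(\overline2),(\overline1\,\overline2),(1\,2),(1\,2)(\overline3),(\overline1\,\overline2)(\overline3),(\overline2)(\overline3),(\overline1)(\overline2)(\overline3),(\overline1)(\overline3),(\overline3),(\overline1\,\overline3),(\overline1\,\overline3)(\overline2),(1\,3)(\overline2),(1\,3),(2\,3),(\overline1)(2\,3),(\overline1)(\overline2\,\overline3),(\overline2\,\overline3))$. For $n\geq4$, $\mathrm{GCB}(n)$ is the concatenation of $\mathrm{GCB}(n-1)\cdot n$, then $\overleftarrow{\mathrm{GCB}}(n-1)\cdot\overline n$, then for $i=1,\dots,n-1$ in order, with $F_i=1\,2\cdots(i-1)\,(i+1)\cdots(n-1)$ (the increasing bijection $[n-2]\to[n-1]\setminus\{i\}$): if $i$ is odd, $\mathrm{GCB}(n-2)^{F_i}\cdot(\overline i\,\overline n)$ followed by $\overleftarrow{\mathrm{GCB}}(n-2)^{F_i}\cdot(i\,n)$; if $i$ is even, $\mathrm{GCB}(n-2)^{F_i}\cdot(i\,n)$ followed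 by $\overleftarrow{\mathrm{GCB}}(n-2)^{F_i}\cdot(\overline i\,\overline n)$. Property A1 (for a list of involutions over $[n]$): the first element is $\mathrm{id}$ and the last is $(n-1\;n)$ or $(\overline{n-1}\;\overline n)$. Property A2: each element is obtained from its predecessor, in one-line notation, by one of: (i) exchanging the entries in two positions, or (ii) cyclically rotating the entries in three positions, in either case possibly also changing the signs of at most two entries; or (iii) changing the signs of one or two entries. *)

theory Defs
  imports "HOL-Combinatorics.Permutations"
begin

text \<open>
  Permutations of \<open>\<plusminus>N\<close> are functions \<open>int \<Rightarrow> int\<close> that are the identity off \<open>\<plusminus>N\<close>, as usual for
  \<^const>\<open>permutes\<close>. Consequently extending a permutation of \<open>\<plusminus>N\<close> to one of \<open>\<plusminus>(N \<union> {k})\<close>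
  that fixes \<open>k\<close> does not change the underlying function.
\<close>

definition plus_minus :: "int set \<Rightarrow> int set" where
  "plus_minus N = N \<union> uminus ` N"

definition signed_perms :: "int set \<Rightarrow> (int \<Rightarrow> int) set" where
  "signed_perms N = {w. w permutes plus_minus N \<and> (\<forall>x\<in>plus_minus N. w (- x) = - w x)}"

definition signed_involutions :: "int set \<Rightarrow> (int \<Rightarrow> int) set" where
  "signed_involutions N = {w \<in> signed_perms N. w \<circ> w = id}"

definition one_line :: "nat \<Rightarrow> (int \<Rightarrow> int) \<Rightarrow> int list" where
  "one_line n w = map w [1..int n]"

text \<open>The cycles \<open>(i j)\<close>, \<open>(-i -j)\<close> and \<open>(-j)\<close>, where \<open>i\<close> and \<open>j\<close> are positive and distinct.\<close>

definition swap_cyc :: "int \<Rightarrow> int \<Rightarrow> int \<Rightarrow> int" where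
  "swap_cyc i j = transpose i j \<circ> transpose (- i) (- j)"

definition bar_swap_cyc :: "int \<Rightarrow> int \<Rightarrow> int \<Rightarrow> int" where
  "bar_swap_cyc i j = transpose i (- j) \<circ> transpose (- i) j"

definition bar_cyc :: "int \<Rightarrow> int \<Rightarrow> int" where
  "bar_cyc j = transpose j (- j)"

definition compose_all :: "(int \<Rightarrow> int) list \<Rightarrow> (int \<Rightarrow> int) \<Rightarrow> (int \<Rightarrow> int) list" where
  "compose_all L c = map (\<lambda>w. w \<circ> c) L"

text \<open>Extension of \<open>F\<close>, given on positive integers, by \<open>F (- j) = - F j\<close>.\<close>

definition odd_ext :: "(int \<Rightarrow> int) \<Rightarrow> int \<Rightarrow> int" where
  "odd_ext F x = sgn x * F \<bar>x\<bar>"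

text \<open>\<open>w\<^sup>F\<close> for \<open>F\<close> injective on \<open>{1..r}\<close> with positive values: \<open>w\<^sup>F (F x) = F (w x)\<close> for
  \<open>x \<in> \<plusminus>{1..r}\<close>, and the identity off \<open>\<plusminus>F ` {1..r}\<close>.\<close>

definition relabel :: "nat \<Rightarrow> (int \<Rightarrow> int) \<Rightarrow> (int \<Rightarrow> int) \<Rightarrow> (int \<Rightarrow> int)" where
  "relabel r F w =
    (let R = plus_minus {1..int r}; G = odd_ext F
     in (\<lambda>y. if y \<in> G ` R then G (w (inv_into R G y)) else y))"

text \<open>The increasing bijection from \<open>{1..n-2}\<close> onto \<open>{1..n-1} - {i}\<close>.\<close>

definition skip :: "int \<Rightarrow> int \<Rightarrow> int" where
  "skip i j = (if j < i then j else j + 1)"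

text \<open>The lists are only meaningful for \<open>n \<ge> 2\<close>; the empty list below that is a dummy value.\<close>

fun GCB :: "nat \<Rightarrow> (int \<Rightarrow> int) list" where
  "GCB n =
    (if n < 2 then []
     else if n = 2 then
       [id, bar_cyc 1, bar_cyc 1 \<circ> bar_cyc 2, bar_cyc 2, bar_swap_cyc 1 2, swap_cyc 1 2]
     else if n = 3 then
       [id, bar_cyc 1, bar_cyc 1 \<circ> bar_cyc 2, bar_cyc 2, bar_swap_cyc 1 2, swap_cyc 1 2,
        swap_cyc 1 2 \<circ> bar_cyc 3, bar_swap_cyc 1 2 \<circ> bar_cyc 3, bar_cyc 2 \<circ> bar_cyc 3,
        bar_cyc 1 \<circ> bar_cyc 2 \<circ> bar_cyc 3, bar_cyc 1 \<circ> bar_cyc 3, bar_cyc 3,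
        bar_swap_cyc 1 3, bar_swap_cyc 1 3 \<circ> bar_cyc 2, swap_cyc 1 3 \<circ> bar_cyc 2,
        swap_cyc 1 3, swap_cyc 2 3, bar_cyc 1 \<circ> swap_cyc 2 3,
        bar_cyc 1 \<circ> bar_swap_cyc 2 3, bar_swap_cyc 2 3]
     else
       GCB (n - 1) @ compose_all (rev (GCB (n - 1))) (bar_cyc (int n)) @
       concat (map (\<lambda>i.
         let L = map (relabel (n - 2) (skip i)) (GCB (n - 2)) in
         if odd i
         then compose_all L (bar_swap_cyc i (int n)) @ compose_all (rev L) (swap_cyc i (int n))
         else compose_all L (swap_cyc i (int n)) @ compose_all (rev L) (bar_swap_cyc i (int n)))
         [1..int n - 1]))"

declare GCB.simps [simp del]

definition lists_involutions_once :: "nat \<Rightarrow> (int \<Rightarrow> int) list \<Rightarrow> bool" where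
  "lists_involutions_once n L \<longleftrightarrow> distinct L \<and> set L = signed_involutions {1..int n}"

definition property_A1 :: "nat \<Rightarrow> (int \<Rightarrow> int) list \<Rightarrow> bool" where
  "property_A1 n L \<longleftrightarrow> L \<noteq> [] \<and> hd L = id \<and>
    (last L = swap_cyc (int n - 1) (int n) \<or> last L = bar_swap_cyc (int n - 1) (int n))"

definition exchanges_two :: "int list \<Rightarrow> int list \<Rightarrow> bool" where
  "exchanges_two u v \<longleftrightarrow>
    (\<exists>i j. i < length u \<and> j < length u \<and> i \<noteq> j \<and> v = u[i := u ! j, j := u ! i])"

text \<open>Both directions of rotation are covered, as \<open>i, j, k\<close> need not be increasing.\<close>

definition rotates_three :: "int list \<Rightarrow> int list \<Rightarrow> bool" where
  "rotates_three u v \<longleftrightarrow>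
    (\<exists>i j k. i < length u \<and> j < length u \<and> k < length u \<and> i \<noteq> j \<and> i \<noteq> k \<and> j \<noteq> k \<and>
      v = u[i := u ! j, j := u ! k, k := u ! i])"

definition change_signs :: "nat set \<Rightarrow> int list \<Rightarrow> int list" where
  "change_signs S u = map (\<lambda>p. if p \<in> S then - (u ! p) else u ! p) [0..<length u]"

definition A2_step :: "int list \<Rightarrow> int list \<Rightarrow> bool" where
  "A2_step u v \<longleftrightarrow>
    (\<exists>x S. (exchanges_two u x \<or> rotates_three u x) \<and>
       S \<subseteq> {..<length u} \<and> card S \<le> 2 \<and> v = change_signs S x) \<or>
    (\<exists>S. S \<subseteq> {..<length u} \<and> (card S = 1 \<or> card S = 2) \<and> v = change_signs S u)"

definition property_A2 :: "nat \<Rightarrow> (int \<Rightarrow> int) list \<Rightarrow> bool" where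
  "property_A2 n L \<longleftrightarrow>
    (\<forall>l. Suc l < length L \<longrightarrow> A2_step (one_line n (L ! l)) (one_line n (L ! Suc l)))"

definition cyclic_A2 :: "nat \<Rightarrow> (int \<Rightarrow> int) list \<Rightarrow> bool" where
  "cyclic_A2 n L \<longleftrightarrow> L \<noteq> [] \<and> A2_step (one_line n (last L)) (one_line n (hd L))"

end

theory Submission
  imports Defs
begin

text \<open>
  A signed involution \<open>v\<close> of \<open>{1..n}\<close> is determined by \<open>v n \<in> \<plusminus>{1..n}\<close> and an involution of the
  letters other than \<open>n\<close> and \<open>\<bar>v n\<bar>\<close>; the pieces of \<open>GCB n\<close> run through the possible values
  \<open>n, -n, \<plusminus>1, \<dots>, \<plusminus>(n - 1)\<close>, which gives completeness and distinctness.

  For A2, a step is a rearrangement of places together with a set of places whose signs change. In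
  this form the relation is symmetric, so reversed lists keep it, and it is transported along any
  injection of places that is compatible with an odd map of values. As each list starts with the
  identity, only the pure cycles meet where one block ends and the next begins, and there the step is
  written down explicitly.
\<close>

section \<open>Signed involutions\<close>

lemma mem_plus_minus: "x \<in> plus_minus N \<longleftrightarrow> x \<in> N \<or> - x \<in> N"
  unfolding plus_minus_def by (auto simp: image_iff) (metis minus_minus)

text \<open>A self-inverse function is a bijection, so \<open>permutes\<close> reduces to fixing
  every point off \<open>plus_minus N\<close>. Off that set oddness is automatic, because the set is
  closed under negation. Membership thus becomes a list of equations over all integers.\<close>

lemma signed_involutions_iff:
  "w \<in> signed_involutions N \<longleftrightarrow>
     (\<forall>x. w (w x) = x) \<and> (\<forall>x. w (- x) = - w x) \<and> (\<forall>x. x \<notin> N \<longrightarrow> - x \<notin> N \<longrightarrow> w x = x)"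
  (is "?l \<longleftrightarrow> ?r")
proof
  assume l: ?l
  then have p: "w permutes plus_minus N"
    and o: "\<And>x. x \<in> plus_minus N \<Longrightarrow> w (- x) = - w x" and i: "w \<circ> w = id"
    by (auto simp: signed_involutions_def signed_perms_def)
  have fix0: "w x = x" if "x \<notin> plus_minus N" for x
    using p that by (rule permutes_not_in)
  have "w (- x) = - w x" for x
    using o fix0 by (cases "x \<in> plus_minus N") (auto simp: mem_plus_minus)
  then show ?r using i fix0 by (auto simp: mem_plus_minus fun_eq_iff)
next
  assume r: ?r
  have "w permutes plus_minus N"
    unfolding permutes_def using r by (auto simp: mem_plus_minus) metis+
  then show ?l using r
    by (auto simp: signed_involutions_def signed_perms_def fun_eq_iff)
qed

lemma signed_involutionsD:
  assumes "w \<in> signed_involutions N"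
  shows "w (w x) = x" and "w (- x) = - w x" and "x \<notin> plus_minus N \<Longrightarrow> w x = x"
    and "w x \<in> plus_minus N \<longleftrightarrow> x \<in> plus_minus N"
proof -
  show *: "w (w x) = x" for x using assms by (simp add: signed_involutions_iff)
  show "w (- x) = - w x" using assms by (simp add: signed_involutions_iff)
  show **: "x \<notin> plus_minus N \<Longrightarrow> w x = x" for x
    using assms by (simp add: signed_involutions_iff mem_plus_minus)
  show "w x \<in> plus_minus N \<longleftrightarrow> x \<in> plus_minus N"
    using *[of x] **[of x] **[of "w x"] by metis
qed

section \<open>Elementary cycles as signed involutions\<close>

lemma id_signed_involution: "id \<in> signed_involutions N"
  by (simp add: signed_involutions_iff)

lemma bar_cyc_signed_involution: "bar_cyc j \<in> signed_involutions {j}"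
  by (auto simp: signed_involutions_iff bar_cyc_def transpose_def)

lemma swap_cyc_signed_involution:
  "0 < i \<Longrightarrow> i < j \<Longrightarrow> swap_cyc i j \<in> signed_involutions {i, j}"
  by (auto simp: signed_involutions_iff swap_cyc_def transpose_def)

lemma bar_swap_cyc_signed_involution:
  "0 < i \<Longrightarrow> i < j \<Longrightarrow> bar_swap_cyc i j \<in> signed_involutions {i, j}"
  by (auto simp: signed_involutions_iff bar_swap_cyc_def transpose_def)

text \<open>Since \<open>c\<close> is its own inverse, the only candidate for the left factor of
  \<open>v\<close> is \<open>v \<circ> c\<close>. Agreement of \<open>v\<close> with
  \<open>c\<close> on \<open>M\<close> makes this factor fix \<open>plus_minus M\<close>, so it
  moves only letters of \<open>N\<close>. Every piece of \<open>GCB n\<close> is identified by an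
  instance of this lemma.\<close>

lemma signed_involutions_comp_disjoint:
  assumes c: "c \<in> signed_involutions M" and disj: "plus_minus M \<inter> plus_minus N = {}"
  shows "(\<lambda>w. w \<circ> c) ` signed_involutions N =
           {v \<in> signed_involutions (N \<union> M). \<forall>x\<in>M. v x = c x}" (is "?L = ?R")
proof
  show "?L \<subseteq> ?R"
  proof
    fix v assume "v \<in> ?L"
    then obtain w where w: "w \<in> signed_involutions N" and v: "v = w \<circ> c" by auto
    have onM: "v x = c x" if "x \<in> plus_minus M" for x
      using signed_involutionsD[OF c] signed_involutionsD[OF w] that disj unfolding v
      by (metis IntI comp_apply empty_iff)
    have offM: "v x = w x" if "x \<notin> plus_minus M" for x
      using signed_involutionsD(3)[OF c that] by (simp add: v)
    have "v (v x) = x" for x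
    proof (cases "x \<in> plus_minus M")
      case True
      then show ?thesis using onM signed_involutionsD[OF c] by metis
    next
      case False
      then have "w x \<notin> plus_minus M"
        using signed_involutionsD[OF w] disj by (metis IntI empty_iff)
      then show ?thesis using False offM signed_involutionsD[OF w] by simp
    qed
    moreover have "v (- x) = - v x" for x
      by (simp add: v signed_involutionsD(2)[OF c] signed_involutionsD(2)[OF w])
    moreover have "v x = x" if "x \<notin> N \<union> M" "- x \<notin> N \<union> M" for x
      using that offM signed_involutionsD(3)[OF w] by (auto simp: mem_plus_minus)
    ultimately show "v \<in> ?R"
      using onM by (auto simp: signed_involutions_iff mem_plus_minus)
  qed
  show "?R \<subseteq> ?L"
  proof
    fix v assume "v \<in> ?R"
    then have v: "v \<in> signed_involutions (N \<union> M)" and vM: "\<And>x. x \<in> M \<Longrightarrow> v x = c x" by auto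
    note vD = signed_involutionsD[OF v] and cD = signed_involutionsD[OF c]
    have onM: "v x = c x" if "x \<in> plus_minus M" for x
      using that vM vD(2) cD(2) unfolding mem_plus_minus by (metis minus_minus)
    define w where "w = v \<circ> c"
    have wM: "w x = x" if "x \<in> plus_minus M" for x
      using that onM cD by (simp add: w_def)
    have woff: "w x = v x" if "x \<notin> plus_minus M" for x
      using cD(3)[OF that] by (simp add: w_def)
    \<comment> \<open>On \<open>plus_minus M\<close> the map \<open>v\<close> acts as
      \<open>c\<close> and stays inside; being an involution, it then also preserves the
      complement.\<close>
    have voff: "v x \<notin> plus_minus M" if "x \<notin> plus_minus M" for x
      using that onM cD(4) vD(1) by metis
    have "w (w x) = x" for x
      by (cases "x \<in> plus_minus M") (simp_all add: wM woff voff vD)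
    moreover have "w (- x) = - w x" for x
      by (simp add: w_def cD vD)
    moreover have "w x = x" if "x \<notin> N" "- x \<notin> N" for x
    proof (cases "x \<in> plus_minus M")
      case False
      then have "x \<notin> plus_minus (N \<union> M)" using that by (auto simp: mem_plus_minus)
      then show ?thesis using False woff vD(3) by simp
    qed (simp add: wM)
    ultimately have "w \<in> signed_involutions N" by (simp add: signed_involutions_iff)
    moreover have "v = w \<circ> c" by (simp add: w_def fun_eq_iff cD)
    ultimately show "v \<in> ?L" by blast
  qed
qed

section \<open>Involutions sorted by their value at the largest letter\<close>

lemma inj_comp_signed_involution:
  "c \<in> signed_involutions M \<Longrightarrow> inj_on (\<lambda>w. w \<circ> c) A"
  by (rule inj_onI) (metis comp_apply ext signed_involutionsD(1))

lemma distinct_compose_all: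
  "distinct L \<Longrightarrow> c \<in> signed_involutions M \<Longrightarrow> distinct (compose_all L c)"
  unfolding compose_all_def distinct_map by (blast intro: inj_comp_signed_involution)

text \<open>The case of one extra letter with \<open>c = id\<close>. Extension by a fixed letter
  leaves the underlying function alone, so the first piece of the list is literally the previous
  list.\<close>

lemma signed_involutions_fixing:
  assumes "k > 0" and "\<And>x. x \<in> N \<Longrightarrow> 0 < x \<and> x < k"
  shows "signed_involutions N = {v \<in> signed_involutions (insert k N). v k = k}"
proof -
  have "plus_minus {k} \<inter> plus_minus N = {}"
    using assms by (force simp: mem_plus_minus)
  from signed_involutions_comp_disjoint[OF id_signed_involution this]
  show ?thesis by simp
qed

lemma signed_involutions_negating:
  assumes "k > 0" and "\<And>x. x \<in> N \<Longrightarrow> 0 < x \<and> x < k"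
  shows "(\<lambda>w. w \<circ> bar_cyc k) ` signed_involutions N =
           {v \<in> signed_involutions (insert k N). v k = - k}"
proof -
  have "plus_minus {k} \<inter> plus_minus N = {}"
    using assms by (force simp: mem_plus_minus)
  from signed_involutions_comp_disjoint[OF bar_cyc_signed_involution this]
  show ?thesis by (simp add: bar_cyc_def)
qed

text \<open>The cycle prescribes the values at both \<open>i\<close> and \<open>k\<close>, but for
  an odd involution the value at \<open>k\<close> already forces the one at \<open>i\<close>. One
  condition on \<open>v k\<close> therefore describes each set.\<close>

lemma signed_involutions_swapping:
  assumes N: "\<And>x. x \<in> N \<Longrightarrow> 0 < x \<and> x < k" and i: "i \<in> N"
  shows "(\<lambda>w. w \<circ> swap_cyc i k) ` signed_involutions (N - {i}) =
           {v \<in> signed_involutions (insert k N). v k = i}" (is ?swap)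
    and "(\<lambda>w. w \<circ> bar_swap_cyc i k) ` signed_involutions (N - {i}) =
           {v \<in> signed_involutions (insert k N). v k = - i}" (is ?bar)
proof -
  have ik: "0 < i" "i < k" using N i by auto
  have "x \<notin> plus_minus (N - {i})" if "x \<in> plus_minus {i, k}" for x
    using N[of x] N[of "- x"] ik that by (auto simp: mem_plus_minus)
  then have disj: "plus_minus {i, k} \<inter> plus_minus (N - {i}) = {}" by auto
  have un: "N - {i} \<union> {i, k} = insert k N" using i by auto
  have "v i = k" if "v \<in> signed_involutions (insert k N)" "v k = i" for v
    using signed_involutionsD(1)[OF that(1), of k] that(2) by simp
  then show ?swap
    unfolding signed_involutions_comp_disjoint[OF swap_cyc_signed_involution[OF ik] disj] un
    using ik by (auto simp: swap_cyc_def transpose_def)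
  have "v i = - k" if "v \<in> signed_involutions (insert k N)" "v k = - i" for v
    using signed_involutionsD(1,2)[OF that(1), of k] signed_involutionsD(2)[OF that(1), of i]
      that(2) by simp
  then show ?bar
    unfolding signed_involutions_comp_disjoint[OF bar_swap_cyc_signed_involution[OF ik] disj] un
    using ik by (auto simp: bar_swap_cyc_def transpose_def)
qed

section \<open>Relabelling\<close>

lemma odd_ext_minus: "odd_ext F (- x) = - odd_ext F x"
  by (simp add: odd_ext_def sgn_minus)

lemma odd_ext_pos: "x > 0 \<Longrightarrow> odd_ext F x = F x"
  by (simp add: odd_ext_def)

text \<open>As \<open>F\<close> is positive, the sign and the absolute value of the argument can be
  read off separately from the value.\<close>

lemma inj_on_odd_ext:
  assumes "inj_on F {1..int r}" and "\<And>x. x \<in> {1..int r} \<Longrightarrow> F x > 0"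
  shows "inj_on (odd_ext F) (plus_minus {1..int r})"
proof (rule inj_onI)
  fix x y assume xy: "x \<in> plus_minus {1..int r}" "y \<in> plus_minus {1..int r}"
    and eq: "odd_ext F x = odd_ext F y"
  have a: "\<bar>x\<bar> \<in> {1..int r}" "\<bar>y\<bar> \<in> {1..int r}" using xy by (auto simp: mem_plus_minus)
  then have pos: "F \<bar>x\<bar> > 0" "F \<bar>y\<bar> > 0" using assms(2) by auto
  have "sgn x = sgn y \<and> F \<bar>x\<bar> = F \<bar>y\<bar>"
    using eq pos a by (auto simp: odd_ext_def sgn_if split: if_splits)
  then have "sgn x = sgn y \<and> \<bar>x\<bar> = \<bar>y\<bar>" using assms(1) a by (auto dest: inj_onD)
  then show "x = y" by (metis sgn_mult_abs)
qed

lemma odd_ext_image: "odd_ext F ` plus_minus {1..int r} = plus_minus (F ` {1..int r})"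
proof -
  have "odd_ext F ` {1..int r} = F ` {1..int r}"
    by (intro image_cong) (auto simp: odd_ext_pos)
  moreover have "odd_ext F ` uminus ` {1..int r} = uminus ` F ` {1..int r}"
    unfolding image_image by (intro image_cong) (auto simp: odd_ext_pos odd_ext_minus)
  ultimately show ?thesis by (simp add: plus_minus_def image_Un)
qed

lemma relabel_apply:
  assumes "inj_on F {1..int r}" and "\<And>x. x \<in> {1..int r} \<Longrightarrow> F x > 0"
    and "x \<in> plus_minus {1..int r}"
  shows "relabel r F w (odd_ext F x) = odd_ext F (w x)"
  using inj_on_odd_ext[OF assms(1,2)] assms(3) by (simp add: relabel_def Let_def)

lemma relabel_outside: "y \<notin> plus_minus (F ` {1..int r}) \<Longrightarrow> relabel r F w y = y"
  by (simp add: relabel_def Let_def odd_ext_image)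

text \<open>This makes both ends of a swap block pure cycles, since the list being relabelled starts
  with \<open>id\<close>.\<close>

lemma relabel_id: "relabel r F id = id"
  by (auto simp: relabel_def fun_eq_iff Let_def f_inv_into_f)

text \<open>Relabelling is conjugation by the odd bijection \<open>?G\<close> from \<open>?R\<close>
  onto \<open>?Q\<close>: involutivity and oddness carry over, and conjugating back yields the
  preimage.\<close>

lemma bij_betw_relabel:
  assumes "inj_on F {1..int r}" and "\<And>x. x \<in> {1..int r} \<Longrightarrow> F x > 0"
  shows "bij_betw (relabel r F) (signed_involutions {1..int r}) (signed_involutions (F ` {1..int r}))"
proof -
  let ?R = "plus_minus {1..int r}" and ?Q = "plus_minus (F ` {1..int r})" and ?G = "odd_ext F"
  have app: "relabel r F w (?G x) = ?G (w x)" if "x \<in> ?R" for x w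
    using assms that by (rule relabel_apply)
  note out = relabel_outside[of _ F r]
  note inj = inj_on_odd_ext[OF assms]
  have Q: "?Q = ?G ` ?R" by (simp add: odd_ext_image)
  have negQ: "- y \<in> ?Q \<longleftrightarrow> y \<in> ?Q" for y by (auto simp: mem_plus_minus)
  have negR: "- y \<in> ?R \<longleftrightarrow> y \<in> ?R" for y by (auto simp: mem_plus_minus)
  have into: "relabel r F w \<in> signed_involutions (F ` {1..int r})"
    if w: "w \<in> signed_involutions {1..int r}" for w
  proof -
    let ?v = "relabel r F w"
    have "?v (?v y) = y \<and> ?v (- y) = - ?v y" for y
    proof (cases "y \<in> ?Q")
      case True
      then obtain x where x: "x \<in> ?R" "y = ?G x" by (auto simp: Q)
      have "?v (- y) = ?G (w (- x))" using app[of "- x" w] x by (simp add: negR odd_ext_minus)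
      then show ?thesis
        using x signed_involutionsD[OF w] by (simp add: app odd_ext_minus)
    qed (simp add: out negQ)
    then show ?thesis by (auto simp: signed_involutions_iff mem_plus_minus out)
  qed
  have "inj_on (relabel r F) (signed_involutions {1..int r})"
  proof (rule inj_onI, rule ext)
    fix w w' x
    assume w: "w \<in> signed_involutions {1..int r}" and w': "w' \<in> signed_involutions {1..int r}"
      and eq: "relabel r F w = relabel r F w'"
    show "w x = w' x"
    proof (cases "x \<in> ?R")
      case True
      then have "?G (w x) = ?G (w' x)" using eq app by metis
      then show ?thesis
        using True inj signed_involutionsD(4)[OF w] signed_involutionsD(4)[OF w']
        by (meson inj_onD)
    qed (simp add: signed_involutionsD(3)[OF w] signed_involutionsD(3)[OF w'])
  qed
  moreover have "v \<in> relabel r F ` signed_involutions {1..int r}"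
    if v: "v \<in> signed_involutions (F ` {1..int r})" for v
  proof -
    note vD = signed_involutionsD[OF v]
    \<comment> \<open>The conjugate of \<open>v\<close> by the inverse of \<open>?G\<close>,
      completed by the identity off \<open>?R\<close>.\<close>
    define w where "w = (\<lambda>x. if x \<in> ?R then inv_into ?R ?G (v (?G x)) else x)"
    have vGQ: "v (?G x) \<in> ?G ` ?R" if "x \<in> ?R" for x
    proof -
      have "?G x \<in> ?Q" unfolding Q using that by blast
      then have "v (?G x) \<in> ?Q" by (simp only: vD(4))
      then show ?thesis by (simp only: Q)
    qed
    have wR: "w x \<in> ?R" "?G (w x) = v (?G x)" if "x \<in> ?R" for x
      using vGQ[OF that] that by (simp_all add: w_def inv_into_into f_inv_into_f)
    \<comment> \<open>Identities for \<open>w\<close> are checked after applying the injective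
      \<open>?G\<close>, which turns \<open>w\<close> into \<open>v\<close>.\<close>
    have eqI: "a = b" if "a \<in> ?R" "b \<in> ?R" "?G a = ?G b" for a b
      using inj that by (meson inj_onD)
    have "w (w x) = x \<and> w (- x) = - w x" for x
    proof (cases "x \<in> ?R")
      case True
      have "w (w x) = x"
        by (rule eqI) (simp_all add: True wR vD)
      moreover have "w (- x) = - w x"
        by (rule eqI) (simp_all add: True wR negR odd_ext_minus vD)
      ultimately show ?thesis by simp
    qed (simp add: w_def negR)
    then have "w \<in> signed_involutions {1..int r}"
      by (auto simp: signed_involutions_iff w_def mem_plus_minus)
    moreover have "v = relabel r F w"
    proof
      fix y show "v y = relabel r F w y"
      proof (cases "y \<in> ?Q")
        case True
        then obtain x where x: "x \<in> ?R" "y = ?G x" by (auto simp: Q)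
        then show ?thesis by (simp add: app wR)
      qed (simp add: out vD)
    qed
    ultimately show ?thesis by blast
  qed
  ultimately show ?thesis using into unfolding bij_betw_def by blast
qed

section \<open>The increasing bijection that omits one letter\<close>

lemma inj_skip: "inj_on (skip i) A"
  by (rule inj_onI) (auto simp: skip_def split: if_splits)

lemma skip_pos: "x > 0 \<Longrightarrow> skip i x > 0"
  by (simp add: skip_def)

lemma skip_image:
  assumes "1 \<le> i" "i \<le> m"
  shows "skip i ` {1..m - 1} = {1..m} - {i}"
proof -
  have "x \<in> skip i ` {1..m - 1}" if "x \<in> {1..m} - {i}" for x
    by (rule image_eqI[of _ _ "if x < i then x else x - 1"]) (use that assms in \<open>auto simp: skip_def\<close>)
  moreover have "skip i ` {1..m - 1} \<subseteq> {1..m} - {i}"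
    using assms by (auto simp: skip_def)
  ultimately show ?thesis by blast
qed

section \<open>Steps as signed rearrangements of positions\<close>

text \<open>The composite \<open>transpose i j \<circ> transpose j k\<close> is the three-cycle
  \<open>i\<close> to \<open>j\<close> to \<open>k\<close> to \<open>i\<close>. A move tells from
  which place each entry is fetched. The type of places is left open because both list indices and
  letters occur.\<close>

definition moves_places :: "'a set \<Rightarrow> ('a \<Rightarrow> 'a) \<Rightarrow> bool" where
  "moves_places P \<tau> \<longleftrightarrow>
     (\<exists>i\<in>P. \<exists>j\<in>P. i \<noteq> j \<and> \<tau> = transpose i j) \<or>
     (\<exists>i\<in>P. \<exists>j\<in>P. \<exists>k\<in>P. i \<noteq> j \<and> i \<noteq> k \<and> j \<noteq> k \<and> \<tau> = transpose i j \<circ> transpose j k)"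

text \<open>Merging the kinds of step in A2 into one formula makes inversion and transport uniform.
  The set \<open>S\<close> refers to places after the move, and \<open>S \<noteq> {}\<close> keeps
  standing still from counting as a pure sign change.\<close>

definition signed_step :: "'a set \<Rightarrow> ('a \<Rightarrow> int) \<Rightarrow> ('a \<Rightarrow> int) \<Rightarrow> bool" where
  "signed_step P f g \<longleftrightarrow>
     (\<exists>\<tau> S. S \<subseteq> P \<and> finite S \<and> card S \<le> 2 \<and> (moves_places P \<tau> \<or> \<tau> = id \<and> S \<noteq> {}) \<and>
       (\<forall>p\<in>P. g p = (if p \<in> S then - f (\<tau> p) else f (\<tau> p))))"

lemma moves_places_transpose:
  "i \<in> P \<Longrightarrow> j \<in> P \<Longrightarrow> i \<noteq> j \<Longrightarrow> moves_places P (transpose i j)"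
  unfolding moves_places_def by (intro disjI1 bexI[of _ i] bexI[of _ j] conjI refl)

lemma moves_places_rotation:
  "i \<in> P \<Longrightarrow> j \<in> P \<Longrightarrow> k \<in> P \<Longrightarrow> i \<noteq> j \<Longrightarrow> i \<noteq> k \<Longrightarrow> j \<noteq> k \<Longrightarrow>
     moves_places P (transpose i j \<circ> transpose j k)"
  unfolding moves_places_def
  by (intro disjI2 bexI[of _ i] bexI[of _ j] bexI[of _ k] conjI refl)

lemma moves_places_closed: "moves_places P \<tau> \<Longrightarrow> p \<in> P \<Longrightarrow> \<tau> p \<in> P"
  by (auto simp: moves_places_def transpose_def)

text \<open>A transposition inverts itself; for a three-cycle the two transpositions are composed in
  the opposite order, which is a three-cycle again.\<close>

lemma moves_places_inverse:
  assumes "moves_places P \<tau>"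
  obtains \<sigma> where "moves_places P \<sigma>" "\<And>p. \<sigma> (\<tau> p) = p" "\<And>p. \<tau> (\<sigma> p) = p"
  using assms unfolding moves_places_def
proof (elim disjE bexE conjE)
  fix i j assume "i \<in> P" "j \<in> P" "i \<noteq> j" "\<tau> = transpose i j"
  then show thesis by (intro that[of \<tau>]) (auto simp: moves_places_def)
next
  fix i j k assume a: "i \<in> P" "j \<in> P" "k \<in> P" "i \<noteq> j" "i \<noteq> k" "j \<noteq> k"
    and \<tau>: "\<tau> = transpose i j \<circ> transpose j k"
  have "moves_places P (transpose k j \<circ> transpose j i)"
    using a by (intro moves_places_rotation) auto
  then show thesis
    by (rule that) (simp_all add: \<tau> transpose_commute[of k j] transpose_commute[of j i])
qed

text \<open>The same transposition or rotation is performed on the images of the places involved;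
  injectivity of \<open>F\<close> keeps these distinct.\<close>

lemma moves_places_image:
  assumes "moves_places P \<tau>" and inj: "inj_on F P" and sub: "F ` P \<subseteq> Q"
  obtains \<sigma> where "moves_places Q \<sigma>" "\<And>p. p \<in> P \<Longrightarrow> \<sigma> (F p) = F (\<tau> p)"
    "\<And>q. q \<notin> F ` P \<Longrightarrow> \<sigma> q = q"
proof -
  have tr: "transpose (F i) (F j) (F p) = F (transpose i j p)" if "i \<in> P" "j \<in> P" "p \<in> P" for i j p
    using that inj by (auto simp: transpose_def inj_on_eq_iff)
  have fixed: "transpose (F i) (F j) q = q" if "i \<in> P" "j \<in> P" "q \<notin> F ` P" for i j q
    using that by (auto simp: transpose_def)
  show thesis
    using assms(1) unfolding moves_places_def
  proof (elim disjE bexE conjE)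
    fix i j assume a: "i \<in> P" "j \<in> P" "i \<noteq> j" "\<tau> = transpose i j"
    have "F i \<noteq> F j" using a inj by (simp add: inj_on_eq_iff)
    then have "moves_places Q (transpose (F i) (F j))"
      using a sub by (intro moves_places_transpose) auto
    then show thesis by (rule that) (simp_all add: a tr fixed)
  next
    fix i j k assume a: "i \<in> P" "j \<in> P" "k \<in> P" "i \<noteq> j" "i \<noteq> k" "j \<noteq> k"
      "\<tau> = transpose i j \<circ> transpose j k"
    have ne: "F i \<noteq> F j" "F i \<noteq> F k" "F j \<noteq> F k" using a inj by (simp_all add: inj_on_eq_iff)
    have Q: "F i \<in> Q" "F j \<in> Q" "F k \<in> Q" using a sub by auto
    \<comment> \<open>\<open>tr\<close> speaks only of places in \<open>P\<close>, so the place
      reached after the first factor must lie there too.\<close>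
    have closed: "transpose j k p \<in> P" if "p \<in> P" for p
      using a that by (auto simp: transpose_def)
    have "moves_places Q (transpose (F i) (F j) \<circ> transpose (F j) (F k))"
      using ne Q by (intro moves_places_rotation)
    then show thesis by (rule that) (simp_all add: a tr fixed closed)
  qed
qed

text \<open>The transport principle behind all lifted steps. The move is carried along
  \<open>F\<close>, the sign set becomes the image of \<open>S\<close> under \<open>F\<close>, and
  the odd map \<open>G\<close> of values commutes with sign changes. Places outside the image keep
  their entries.\<close>

lemma signed_step_image:
  assumes step: "signed_step P f g" and inj: "inj_on F P" and sub: "F ` P \<subseteq> Q"
    and G: "\<And>x. G (- x) = - G x"
    and f': "\<And>p. p \<in> P \<Longrightarrow> f' (F p) = G (f p)" and g': "\<And>p. p \<in> P \<Longrightarrow> g' (F p) = G (g p)"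
    and rest: "\<And>q. q \<in> Q \<Longrightarrow> q \<notin> F ` P \<Longrightarrow> g' q = f' q"
  shows "signed_step Q f' g'"
proof -
  from step obtain \<tau> S where S: "S \<subseteq> P" "finite S" "card S \<le> 2"
    and \<tau>: "moves_places P \<tau> \<or> \<tau> = id \<and> S \<noteq> {}"
    and g: "\<And>p. p \<in> P \<Longrightarrow> g p = (if p \<in> S then - f (\<tau> p) else f (\<tau> p))"
    unfolding signed_step_def by blast
  have \<tau>P: "\<tau> p \<in> P" if "p \<in> P" for p
    using \<tau> that moves_places_closed by (auto simp: id_def)
  obtain \<sigma> where \<sigma>: "moves_places Q \<sigma> \<or> \<sigma> = id \<and> S \<noteq> {}"
    "\<And>p. p \<in> P \<Longrightarrow> \<sigma> (F p) = F (\<tau> p)" "\<And>q. q \<notin> F ` P \<Longrightarrow> \<sigma> q = q"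
  proof (cases "moves_places P \<tau>")
    case True
    show ?thesis
      by (rule moves_places_image[OF True inj sub], rule that, rule disjI1)
  next
    case False
    then show ?thesis using \<tau> by (intro that[of id]) simp_all
  qed
  have mem: "F p \<in> F ` S \<longleftrightarrow> p \<in> S" if "p \<in> P" for p
    using inj_on_image_mem_iff[OF inj that S(1)] .
  have "g' q = (if q \<in> F ` S then - f' (\<sigma> q) else f' (\<sigma> q))" if "q \<in> Q" for q
  proof (cases "q \<in> F ` P")
    case True
    then obtain p where "p \<in> P" "q = F p" by auto
    then show ?thesis using mem by (simp add: g' g \<sigma>(2) f' \<tau>P G)
  next
    case False
    then have "q \<notin> F ` S" using S(1) by auto
    then show ?thesis using False that by (simp add: \<sigma>(3) rest)
  qed
  moreover have "card (F ` S) \<le> 2" using S card_image_le le_trans by blast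
  moreover have "F ` S \<subseteq> Q" using S sub by auto
  moreover have "moves_places Q \<sigma> \<or> \<sigma> = id \<and> F ` S \<noteq> {}" using \<sigma>(1) by auto
  ultimately show ?thesis unfolding signed_step_def using S(2) by blast
qed

text \<open>Solve for \<open>f\<close> with the inverse move. Signs travel with the entries, so the
  inverse step negates at the image of \<open>S\<close> under \<open>\<tau>\<close>.\<close>

lemma signed_step_sym:
  assumes "signed_step P f g"
  shows "signed_step P g f"
proof -
  from assms obtain \<tau> S where S: "S \<subseteq> P" "finite S" "card S \<le> 2"
    and \<tau>: "moves_places P \<tau> \<or> \<tau> = id \<and> S \<noteq> {}"
    and g: "\<And>p. p \<in> P \<Longrightarrow> g p = (if p \<in> S then - f (\<tau> p) else f (\<tau> p))"
    unfolding signed_step_def by blast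
  have \<tau>P: "\<tau> p \<in> P" if "p \<in> P" for p
    using \<tau> that moves_places_closed by (auto simp: id_def)
  obtain \<sigma> where \<sigma>: "moves_places P \<sigma> \<or> \<sigma> = id \<and> S \<noteq> {}" "\<And>p. \<sigma> (\<tau> p) = p" "\<And>p. \<tau> (\<sigma> p) = p"
  proof (cases "moves_places P \<tau>")
    case True
    show ?thesis
      by (rule moves_places_inverse[OF True], rule that, rule disjI1)
  next
    case False
    then show ?thesis using \<tau> by (intro that[of id]) simp_all
  qed
  have \<sigma>P: "\<sigma> p \<in> P" if "p \<in> P" for p
    using \<sigma>(1) that moves_places_closed by (auto simp: id_def)
  have mem: "p \<in> \<tau> ` S \<longleftrightarrow> \<sigma> p \<in> S" for p
    using \<sigma> by (metis imageE image_eqI)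
  have "f p = (if p \<in> \<tau> ` S then - g (\<sigma> p) else g (\<sigma> p))" if "p \<in> P" for p
    unfolding mem using that by (simp add: g \<sigma>P \<sigma>)
  moreover have "card (\<tau> ` S) \<le> 2" using S card_image_le le_trans by blast
  moreover have "\<tau> ` S \<subseteq> P" using S \<tau>P by auto
  moreover have "moves_places P \<sigma> \<or> \<sigma> = id \<and> \<tau> ` S \<noteq> {}" using \<sigma>(1) by auto
  ultimately show ?thesis unfolding signed_step_def using S(2) by blast
qed

section \<open>From A2 for one-line words to signed steps\<close>

lemma exchanges_or_rotates_iff:
  "exchanges_two u x \<or> rotates_three u x \<longleftrightarrow>
     length x = length u \<and>
     (\<exists>\<tau>. moves_places {..<length u} \<tau> \<and> (\<forall>p<length u. x ! p = u ! \<tau> p))"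
proof -
  have "exchanges_two u x \<longleftrightarrow> length x = length u \<and>
    (\<exists>i j. i < length u \<and> j < length u \<and> i \<noteq> j \<and> (\<forall>p<length u. x ! p = u ! transpose i j p))"
  proof -
    have "u[i := u ! j, j := u ! i] ! p = u ! transpose i j p"
      if "p < length u" "i \<noteq> j" for i j p
      using that by (simp add: nth_list_update transpose_def)
    then have "i \<noteq> j \<and> x = u[i := u ! j, j := u ! i] \<longleftrightarrow>
       i \<noteq> j \<and> length x = length u \<and> (\<forall>p<length u. x ! p = u ! transpose i j p)" for i j
      by (simp add: list_eq_iff_nth_eq cong: conj_cong)
    then have "exchanges_two u x \<longleftrightarrow> (\<exists>i j. i < length u \<and> j < length u \<and> i \<noteq> j \<and>
        length x = length u \<and> (\<forall>p<length u. x ! p = u ! transpose i j p))"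
      by (simp only: exchanges_two_def)
    then show ?thesis by (simp only:) blast
  qed
  moreover have "rotates_three u x \<longleftrightarrow> length x = length u \<and>
    (\<exists>i j k. i < length u \<and> j < length u \<and> k < length u \<and> i \<noteq> j \<and> i \<noteq> k \<and> j \<noteq> k \<and>
      (\<forall>p<length u. x ! p = u ! (transpose i j \<circ> transpose j k) p))"
  proof -
    have "u[i := u ! j, j := u ! k, k := u ! i] ! p = u ! (transpose i j \<circ> transpose j k) p"
      if "p < length u" "i \<noteq> j" "i \<noteq> k" "j \<noteq> k" for i j k p
      using that by (simp add: nth_list_update transpose_def)
    then have "i \<noteq> j \<and> i \<noteq> k \<and> j \<noteq> k \<and> x = u[i := u ! j, j := u ! k, k := u ! i] \<longleftrightarrow>
       i \<noteq> j \<and> i \<noteq> k \<and> j \<noteq> k \<and> length x = length u \<and>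
       (\<forall>p<length u. x ! p = u ! (transpose i j \<circ> transpose j k) p)" for i j k
      by (simp add: list_eq_iff_nth_eq cong: conj_cong)
    then have "rotates_three u x \<longleftrightarrow>
      (\<exists>i j k. i < length u \<and> j < length u \<and> k < length u \<and> i \<noteq> j \<and> i \<noteq> k \<and> j \<noteq> k \<and>
        length x = length u \<and> (\<forall>p<length u. x ! p = u ! (transpose i j \<circ> transpose j k) p))"
      by (simp only: rotates_three_def)
    then show ?thesis by (simp only:) blast
  qed
  \<comment> \<open>Splitting \<open>moves_places\<close> under an arbitrary predicate
    \<open>Q\<close> lets the two preceding equivalences be combined by rewriting alone.\<close>
  moreover have "(\<exists>\<tau>. moves_places {..<m} \<tau> \<and> Q \<tau>) \<longleftrightarrow>
    (\<exists>i j. i < m \<and> j < m \<and> i \<noteq> j \<and> Q (transpose i j)) \<or>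
    (\<exists>i j k. i < m \<and> j < m \<and> k < m \<and> i \<noteq> j \<and> i \<noteq> k \<and> j \<noteq> k \<and> Q (transpose i j \<circ> transpose j k))"
    (is "?l \<longleftrightarrow> ?r") for m :: nat and Q
  proof
    assume ?l
    then obtain \<tau> where "moves_places {..<m} \<tau>" "Q \<tau>" by blast
    then show ?r unfolding moves_places_def
      by (elim disjE bexE conjE) (simp_all only: lessThan_iff, blast+)
  next
    assume ?r
    then show ?l
    proof (elim disjE exE conjE)
      fix i j assume a: "i < m" "j < m" "i \<noteq> j" "Q (transpose i j)"
      then have "moves_places {..<m} (transpose i j)"
        by (simp add: moves_places_transpose)
      then show ?l using a by blast
    next
      fix i j k assume a: "i < m" "j < m" "k < m" "i \<noteq> j" "i \<noteq> k" "j \<noteq> k"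
        "Q (transpose i j \<circ> transpose j k)"
      then have "moves_places {..<m} (transpose i j \<circ> transpose j k)"
        by (simp add: moves_places_rotation)
      then show ?l using a by blast
    qed
  qed
  ultimately show ?thesis by (simp only: conj_disj_distribL)
qed

lemma eq_change_signs_iff:
  "v = change_signs S x \<longleftrightarrow>
     length v = length x \<and> (\<forall>p<length x. v ! p = (if p \<in> S then - (x ! p) else x ! p))"
  by (auto simp: change_signs_def intro!: nth_equalityI)

lemma A2_step_iff:
  "A2_step u v \<longleftrightarrow> length v = length u \<and> signed_step {..<length u} ((!) u) ((!) v)" (is "?l \<longleftrightarrow> ?r")
proof
  assume ?l
  then consider
    (move) x S where "exchanges_two u x \<or> rotates_three u x" "S \<subseteq> {..<length u}" "card S \<le> 2"
      "v = change_signs S x" |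
    (signs) S where "S \<subseteq> {..<length u}" "card S = 1 \<or> card S = 2" "v = change_signs S u"
    unfolding A2_step_def by metis
  then show ?r
  proof cases
    case move
    then obtain \<tau> where "length x = length u" "moves_places {..<length u} \<tau>"
      "\<forall>p<length u. x ! p = u ! \<tau> p" "length v = length u"
      "\<forall>p<length u. v ! p = (if p \<in> S then - (x ! p) else x ! p)"
      unfolding exchanges_or_rotates_iff eq_change_signs_iff by metis
    moreover have "finite S" using move(2) finite_subset by blast
    ultimately show ?r unfolding signed_step_def
      using move(2,3) by (intro conjI exI[of _ \<tau>] exI[of _ S]) simp_all
  next
    case signs
    then have "finite S" "S \<noteq> {}" "card S \<le> 2" using finite_subset by auto
    then show ?r using signs unfolding signed_step_def eq_change_signs_iff
      by (intro conjI exI[of _ id] exI[of _ S]) simp_all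
  qed
next
  assume r: ?r
  then obtain \<tau> S where S: "S \<subseteq> {..<length u}" "finite S" "card S \<le> 2"
    and \<tau>: "moves_places {..<length u} \<tau> \<or> \<tau> = id \<and> S \<noteq> {}"
    and v: "\<And>p. p \<in> {..<length u} \<Longrightarrow> v ! p = (if p \<in> S then - (u ! \<tau> p) else u ! \<tau> p)"
    unfolding signed_step_def by blast
  show ?l
  proof (cases "moves_places {..<length u} \<tau>")
    case True
    \<comment> \<open>The intermediate word of \<open>A2_step\<close>: already rearranged, signs not
      yet changed.\<close>
    define x where "x = map (\<lambda>p. u ! \<tau> p) [0..<length u]"
    have "\<forall>p<length u. x ! p = u ! \<tau> p" "length x = length u" by (simp_all add: x_def)
    then have "exchanges_two u x \<or> rotates_three u x"
      unfolding exchanges_or_rotates_iff using True by blast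
    moreover have "v = change_signs S x"
      using r v by (simp add: eq_change_signs_iff x_def)
    ultimately show ?l using S unfolding A2_step_def by blast
  next
    case False
    then have "\<tau> = id" "S \<noteq> {}" using \<tau> by auto
    then have "card S \<noteq> 0" using S by simp
    then have "card S = 1 \<or> card S = 2" using S by linarith
    moreover have "v = change_signs S u" using r v \<open>\<tau> = id\<close> by (simp add: eq_change_signs_iff)
    ultimately show ?l using S unfolding A2_step_def by blast
  qed
qed

text \<open>Index \<open>p\<close> of the word holds the value at the letter \<open>1 + p\<close>.
  Transport runs along this shift and along its inverse, with the identity on values.\<close>

lemma A2_step_one_line:
  "A2_step (one_line n f) (one_line n g) \<longleftrightarrow> signed_step {1..int n} f g"
proof -
  have nth: "one_line n h ! p = h (1 + int p)" if "p < n" for h p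
    using that by (simp add: one_line_def nth_upto)
  have len: "length (one_line n h) = n" for h by (simp add: one_line_def)
  have "signed_step {..<n} ((!) (one_line n f)) ((!) (one_line n g)) \<longleftrightarrow> signed_step {1..int n} f g"
  proof
    assume a: "signed_step {..<n} ((!) (one_line n f)) ((!) (one_line n g))"
    show "signed_step {1..int n} f g"
    proof (rule signed_step_image[OF a, of "\<lambda>p. 1 + int p" _ "\<lambda>x. x"])
      \<comment> \<open>The shift is onto, so no place is left over and the assumptions are
        contradictory.\<close>
      fix q assume "q \<in> {1..int n}" "q \<notin> (\<lambda>p. 1 + int p) ` {..<n}"
      moreover have "q = 1 + int (nat (q - 1))" "nat (q - 1) < n" if "q \<in> {1..int n}"
        using that by auto
      ultimately show "g q = f q" by blast
    qed (auto simp: nth inj_on_def)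
  next
    assume a: "signed_step {1..int n} f g"
    show "signed_step {..<n} ((!) (one_line n f)) ((!) (one_line n g))"
    proof (rule signed_step_image[OF a, of "\<lambda>q. nat (q - 1)" _ "\<lambda>x. x"])
      fix p assume p: "p \<in> {..<n}" "p \<notin> (\<lambda>q. nat (q - 1)) ` {1..int n}"
      moreover have "p = nat ((1 + int p) - 1)" "1 + int p \<in> {1..int n}" using p by auto
      ultimately show "one_line n g ! p = one_line n f ! p" by blast
    qed (auto simp: nth inj_on_def)
  qed
  then show ?thesis by (simp add: A2_step_iff len)
qed

lemma property_A2_iff: "property_A2 n L \<longleftrightarrow> successively (signed_step {1..int n}) L"
  by (simp add: property_A2_def successively_conv_nth A2_step_one_line)

section \<open>Concatenated, reversed and mapped lists\<close>

lemma successively_concat_map: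
  assumes "\<And>x. x \<in> set xs \<Longrightarrow> B x \<noteq> [] \<and> successively P (B x)"
    and "successively (\<lambda>x y. P (last (B x)) (hd (B y))) xs"
  shows "successively P (concat (map B xs))"
  using assms
proof (induction xs)
  case (Cons x xs)
  then show ?case by (cases xs) (auto simp: successively_append_iff)
qed simp

lemma distinct_concat_map:
  assumes "distinct xs" and "\<And>x. x \<in> set xs \<Longrightarrow> distinct (B x)"
    and "\<And>x y. x \<in> set xs \<Longrightarrow> y \<in> set xs \<Longrightarrow> x \<noteq> y \<Longrightarrow> set (B x) \<inter> set (B y) = {}"
  shows "distinct (concat (map B xs))"
  using assms
proof (induction xs)
  case (Cons x xs)
  have "set (B x) \<inter> set (B y) = {}" if "y \<in> set xs" for y
    using that Cons.prems by (metis distinct.simps(2) list.set_intros)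
  then have "set (B x) \<inter> set (concat (map B xs)) = {}" by auto
  then show ?case using Cons by simp
qed simp

lemma successively_rev_signed_step:
  "successively (signed_step P) L \<Longrightarrow> successively (signed_step P) (rev L)"
  unfolding successively_rev by (erule successively_mono) (rule signed_step_sym)

lemma successively_map_lift:
  assumes "successively P L"
    and "\<And>x y. x \<in> set L \<Longrightarrow> y \<in> set L \<Longrightarrow> P x y \<Longrightarrow> Q (h x) (h y)"
  shows "successively Q (map h L)"
  using assms by (auto simp: successively_conv_nth)

section \<open>Steps with explicit witnesses and lifted steps\<close>

lemma signed_step_signs:
  assumes "S \<subseteq> P" "finite S" "card S \<le> 2" "S \<noteq> {}"
    and "\<And>p. p \<in> P \<Longrightarrow> g p = (if p \<in> S then - f p else f p)"
  shows "signed_step P f g"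
  unfolding signed_step_def using assms by (intro exI[of _ id] exI[of _ S]) simp

lemma signed_step_transpose:
  assumes "i \<in> P" "j \<in> P" "i \<noteq> j" "S \<subseteq> P" "finite S" "card S \<le> 2"
    and "\<And>p. p \<in> P \<Longrightarrow> g p = (if p \<in> S then - f (transpose i j p) else f (transpose i j p))"
  shows "signed_step P f g"
  unfolding signed_step_def using assms
  by (intro exI[of _ "transpose i j"] exI[of _ S]) (simp add: moves_places_transpose)

lemma signed_step_rotation:
  assumes "i \<in> P" "j \<in> P" "k \<in> P" "i \<noteq> j" "i \<noteq> k" "j \<noteq> k" "S \<subseteq> P" "finite S" "card S \<le> 2"
    and "\<And>p. p \<in> P \<Longrightarrow> g p = (if p \<in> S then - f ((transpose i j \<circ> transpose j k) p)
      else f ((transpose i j \<circ> transpose j k) p))"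
  shows "signed_step P f g"
  unfolding signed_step_def
  by (rule exI[of _ "transpose i j \<circ> transpose j k"], rule exI[of _ S])
    (use assms moves_places_rotation[of i P j k] in simp)

text \<open>Both \<open>f\<close> and \<open>g\<close> fix \<open>k\<close> and \<open>-k\<close>,
  so both composites have the entry \<open>c k\<close> at place \<open>k\<close>; elsewhere
  \<open>c\<close> is trivial and the step is carried along the inclusion of places.\<close>

lemma signed_step_extend:
  assumes step: "signed_step {1..k - 1} f g" and k: "k > 0"
    and f: "f \<in> signed_involutions {1..k - 1}" and g: "g \<in> signed_involutions {1..k - 1}"
    and c: "c \<in> signed_involutions {k}"
  shows "signed_step {1..k} (f \<circ> c) (g \<circ> c)"
proof (rule signed_step_image[OF step, of "\<lambda>x. x" _ "\<lambda>x. x"])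
  fix p assume "p \<in> {1..k - 1}"
  then have "c p = p" using k by (intro signed_involutionsD(3)[OF c]) (auto simp: mem_plus_minus)
  then show "(f \<circ> c) p = f p" "(g \<circ> c) p = g p" by simp_all
next
  fix q assume "q \<in> {1..k}" "q \<notin> (\<lambda>x. x) ` {1..k - 1}"
  then have "c q \<in> plus_minus {k}"
    using signed_involutionsD(4)[OF c, of q] by (simp add: mem_plus_minus)
  then have "c q \<notin> plus_minus {1..k - 1}" by (auto simp: mem_plus_minus)
  then show "(g \<circ> c) q = (f \<circ> c) q"
    using signed_involutionsD(3)[OF f] signed_involutionsD(3)[OF g] by simp
qed (use k in auto)

text \<open>Places move along \<open>skip i\<close> and values along its odd extension. At the two
  remaining places \<open>i\<close> and \<open>r + 2\<close> both words show the value of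
  \<open>c\<close>, which relabelled maps leave alone.\<close>

lemma signed_step_relabel:
  assumes step: "signed_step {1..int r} f g" and i: "1 \<le> i" "i \<le> int r + 1"
    and f: "f \<in> signed_involutions {1..int r}" and g: "g \<in> signed_involutions {1..int r}"
    and c: "c \<in> signed_involutions {i, int r + 2}"
  shows "signed_step {1..int r + 2} (relabel r (skip i) f \<circ> c) (relabel r (skip i) g \<circ> c)"
proof -
  have im: "skip i ` {1..int r} = {1..int r + 1} - {i}"
    using skip_image[OF i] by simp
  show ?thesis
  proof (rule signed_step_image[OF step, of "skip i" _ "odd_ext (skip i)"])
    fix p assume p: "p \<in> {1..int r}"
    then have "skip i p \<in> {1..int r + 1} - {i}" using im by blast
    then have "c (skip i p) = skip i p"
      using i by (intro signed_involutionsD(3)[OF c]) (auto simp: mem_plus_minus)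
    moreover have "relabel r (skip i) h (skip i p) = odd_ext (skip i) (h p)" for h
      using relabel_apply[of "skip i" r p h] p
      by (simp add: inj_skip skip_pos odd_ext_pos mem_plus_minus)
    ultimately show "(relabel r (skip i) f \<circ> c) (skip i p) = odd_ext (skip i) (f p)"
      "(relabel r (skip i) g \<circ> c) (skip i p) = odd_ext (skip i) (g p)" by simp_all
  next
    fix q assume "q \<in> {1..int r + 2}" "q \<notin> skip i ` {1..int r}"
    then have "q \<in> {i, int r + 2}" unfolding im by auto
    then have "c q \<in> plus_minus {i, int r + 2}"
      using signed_involutionsD(4)[OF c, of q] by (auto simp: mem_plus_minus)
    then have "c q \<notin> plus_minus (skip i ` {1..int r})"
      unfolding im using i by (auto simp: mem_plus_minus)
    then show "(relabel r (skip i) g \<circ> c) q = (relabel r (skip i) f \<circ> c) q"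
      by (simp add: relabel_outside)
  qed (auto simp: inj_skip im odd_ext_minus)
qed

section \<open>The blocks of the list\<close>

text \<open>The roles alternate with parity, so that the second cycle for \<open>i\<close> and the
  first cycle for \<open>i + 1\<close> are of the same kind, both barred or both unbarred.\<close>

definition first_cyc :: "int \<Rightarrow> int \<Rightarrow> int \<Rightarrow> int" where
  "first_cyc i k = (if odd i then bar_swap_cyc i k else swap_cyc i k)"

definition second_cyc :: "int \<Rightarrow> int \<Rightarrow> int \<Rightarrow> int" where
  "second_cyc i k = (if odd i then swap_cyc i k else bar_swap_cyc i k)"

text \<open>Reversing the second half brings the two copies of the last entry together in the middle
  and puts the two copies of the first entry at the ends.\<close>

definition swap_block :: "nat \<Rightarrow> (int \<Rightarrow> int) list \<Rightarrow> int \<Rightarrow> (int \<Rightarrow> int) list" where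
  "swap_block r B i =
     compose_all (map (relabel r (skip i)) B) (first_cyc i (int r + 2)) @
     compose_all (rev (map (relabel r (skip i)) B)) (second_cyc i (int r + 2))"

lemma GCB_rec:
  assumes "r \<ge> 2"
  shows "GCB (r + 2) = GCB (r + 1) @ compose_all (rev (GCB (r + 1))) (bar_cyc (int r + 2)) @
    concat (map (swap_block r (GCB r)) [1..int r + 1])"
proof -
  have "(\<lambda>i. let L = map (relabel r (skip i)) (GCB r) in
         if odd i
         then compose_all L (bar_swap_cyc i (int r + 2)) @ compose_all (rev L) (swap_cyc i (int r + 2))
         else compose_all L (swap_cyc i (int r + 2)) @ compose_all (rev L) (bar_swap_cyc i (int r + 2)))
    = swap_block r (GCB r)"
    by (auto simp: fun_eq_iff swap_block_def first_cyc_def second_cyc_def Let_def)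
  moreover have "r + 2 - 1 = r + 1" "r + 2 - 2 = r" "int (r + 2) = int r + 2"
    "int (r + 2) - 1 = int r + 1" by simp_all
  ultimately show ?thesis using assms
    by (subst GCB.simps) (simp only: if_False if_True split: if_splits, simp)
qed

lemma first_second_signed_involution:
  assumes "1 \<le> i" "i < k"
  shows "first_cyc i k \<in> signed_involutions {i, k}" "second_cyc i k \<in> signed_involutions {i, k}"
  using assms swap_cyc_signed_involution[of i k] bar_swap_cyc_signed_involution[of i k]
  by (auto simp: first_cyc_def second_cyc_def)

text \<open>Because \<open>w\<close> fixes \<open>i\<close> and \<open>k\<close> and is odd, the two
  words differ exactly in the signs at places \<open>i\<close> and \<open>k\<close>.\<close>

lemma signed_step_swap_sign:
  assumes i: "1 \<le> i" "i < k" and w: "w i = i" "w k = k" "\<And>x. w (- x) = - w x"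
  shows "signed_step {1..k} (w \<circ> first_cyc i k) (w \<circ> second_cyc i k)"
proof -
  have "signed_step {1..k} (w \<circ> swap_cyc i k) (w \<circ> bar_swap_cyc i k)"
    by (rule signed_step_signs[of "{i, k}"])
      (use i w in \<open>auto simp: swap_cyc_def bar_swap_cyc_def transpose_def card_insert_if\<close>)
  then show ?thesis
    using signed_step_sym by (auto simp: first_cyc_def second_cyc_def)
qed

lemma signed_step_next_block:
  assumes i: "1 \<le> i" "i + 1 < k"
  shows "signed_step {1..k} (second_cyc i k) (first_cyc (i + 1) k)"
proof -
  have "signed_step {1..k} (swap_cyc i k) (swap_cyc (i + 1) k)"
    by (rule signed_step_rotation[of i _ k "i + 1" "{}"])
      (use i in \<open>auto simp: swap_cyc_def transpose_def\<close>)
  moreover have "signed_step {1..k} (bar_swap_cyc i k) (bar_swap_cyc (i + 1) k)"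
    \<comment> \<open>The entry \<open>-k\<close> keeps its bar on moving from place
      \<open>i\<close> to place \<open>i + 1\<close>. Entry \<open>i\<close> loses its bar on
      arriving at place \<open>i\<close>, and entry \<open>i + 1\<close> gains one on arriving at
      place \<open>k\<close>.\<close>
    by (rule signed_step_rotation[of i _ k "i + 1" "{i, k}"])
      (use i in \<open>auto simp: bar_swap_cyc_def transpose_def card_insert_if\<close>)
  ultimately show ?thesis by (simp add: first_cyc_def second_cyc_def)
qed

text \<open>As 1 is odd, the target is \<open>bar_swap_cyc 1 k\<close>. The entry \<open>-k\<close>
  moves to place 1 unchanged, and only the 1 arriving at place \<open>k\<close> gains a bar.\<close>

lemma signed_step_first_block:
  assumes "k > 1"
  shows "signed_step {1..k} (bar_cyc k) (first_cyc 1 k)"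
  by (rule signed_step_transpose[of 1 _ k "{k}"])
    (use assms in \<open>auto simp: first_cyc_def bar_cyc_def bar_swap_cyc_def transpose_def\<close>)

text \<open>With \<open>i = k - 1\<close> this is the step that closes the cycle.\<close>

lemma signed_step_to_id:
  assumes i: "1 \<le> i" "i < k"
  shows "signed_step {1..k} (second_cyc i k) id"
proof -
  have "signed_step {1..k} (swap_cyc i k) id"
    by (rule signed_step_transpose[of i _ k "{}"])
      (use i in \<open>auto simp: swap_cyc_def transpose_def\<close>)
  moreover have "signed_step {1..k} (bar_swap_cyc i k) id"
    by (rule signed_step_transpose[of i _ k "{i, k}"])
      (use i in \<open>auto simp: bar_swap_cyc_def transpose_def card_insert_if\<close>)
  ultimately show ?thesis by (simp add: second_cyc_def)
qed

text \<open>The relabelled list runs through the involutions of the letters other than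
  \<open>i\<close> and \<open>r + 2\<close>, so the two halves cover the two signs of the value at
  \<open>r + 2\<close>. Steps inside a half are transported from \<open>B\<close>; between the
  halves only signs change.\<close>

lemma swap_block_props:
  assumes B: "lists_involutions_once r B" "property_A2 r B" "B \<noteq> []" "hd B = id"
    and i: "1 \<le> i" "i \<le> int r + 1"
  shows "swap_block r B i \<noteq> []"
    and "hd (swap_block r B i) = first_cyc i (int r + 2)"
    and "last (swap_block r B i) = second_cyc i (int r + 2)"
    and "distinct (swap_block r B i)"
    and "set (swap_block r B i) =
      {v \<in> signed_involutions {1..int r + 2}. v (int r + 2) = i \<or> v (int r + 2) = - i}"
    and "successively (signed_step {1..int r + 2}) (swap_block r B i)"
proof -
  let ?k = "int r + 2" and ?L = "map (relabel r (skip i)) B"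
  let ?N = "{1..int r + 1}"
  have setB: "set B = signed_involutions {1..int r}" and dist: "distinct B"
    using B(1) by (simp_all add: lists_involutions_once_def)
  have im: "skip i ` {1..int r} = ?N - {i}"
    using skip_image[OF i] by simp
  have bij: "bij_betw (relabel r (skip i)) (set B) (signed_involutions (?N - {i}))"
    using bij_betw_relabel[of "skip i" r] by (simp add: im setB inj_skip skip_pos)
  have L: "?L \<noteq> []" "hd ?L = id" "last (rev ?L) = id" "distinct ?L"
    "set ?L = signed_involutions (?N - {i})"
    using bij B(3,4) dist
    by (auto simp: hd_map relabel_id last_rev distinct_map bij_betw_def)
  have N: "insert ?k ?N = {1..?k}" by auto
  have swapped:
    "(\<lambda>w. w \<circ> swap_cyc i ?k) ` signed_involutions (?N - {i}) =
       {v \<in> signed_involutions {1..?k}. v ?k = i}"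
    "(\<lambda>w. w \<circ> bar_swap_cyc i ?k) ` signed_involutions (?N - {i}) =
       {v \<in> signed_involutions {1..?k}. v ?k = - i}"
    by (rule signed_involutions_swapping[of ?N ?k i, unfolded N]; use i in auto)+
  have c: "first_cyc i ?k \<in> signed_involutions {i, ?k}" "second_cyc i ?k \<in> signed_involutions {i, ?k}"
    using first_second_signed_involution[of i ?k] i by simp_all
  show ne: "swap_block r B i \<noteq> []" using L by (simp add: swap_block_def compose_all_def)
  show "hd (swap_block r B i) = first_cyc i ?k"
    using L by (simp add: swap_block_def compose_all_def hd_map)
  show "last (swap_block r B i) = second_cyc i ?k"
    using L by (simp add: swap_block_def compose_all_def last_map)
  have sets: "set (compose_all ?L (first_cyc i ?k)) =
      {v \<in> signed_involutions {1..?k}. v ?k = (if odd i then - i else i)}"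
    "set (compose_all (rev ?L) (second_cyc i ?k)) =
      {v \<in> signed_involutions {1..?k}. v ?k = (if odd i then i else - i)}"
    unfolding compose_all_def set_map[of "\<lambda>w. w \<circ> _"] set_rev L(5) first_cyc_def second_cyc_def
    using swapped by (cases "odd i"; simp)+
  show "set (swap_block r B i) = {v \<in> signed_involutions {1..?k}. v ?k = i \<or> v ?k = - i}"
    unfolding swap_block_def set_append sets by auto
  have "distinct (compose_all ?L (first_cyc i ?k))" "distinct (compose_all (rev ?L) (second_cyc i ?k))"
    using L(4) c by (simp_all only: distinct_compose_all distinct_rev)
  then show "distinct (swap_block r B i)"
    unfolding swap_block_def distinct_append sets using i by auto
  have step: "successively (signed_step {1..int r}) B" using B(2) by (simp add: property_A2_iff)
  have half: "successively (signed_step {1..?k}) (compose_all ?L c)" if "c \<in> signed_involutions {i, ?k}" for c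
    unfolding compose_all_def map_map
    by (rule successively_map_lift[OF step])
      (use signed_step_relabel[OF _ i _ _ that] setB in \<open>simp add: comp_def\<close>)
  have "compose_all (rev ?L) c = rev (compose_all ?L c)" for c
    by (simp add: compose_all_def rev_map)
  then have "successively (signed_step {1..?k}) (compose_all (rev ?L) (second_cyc i ?k))"
    using successively_rev_signed_step[OF half[OF c(2)]] by simp
  \<comment> \<open>The halves meet at the same relabelled involution, composed with the two
    different cycles.\<close>
  moreover have "last (compose_all ?L (first_cyc i ?k)) = last ?L \<circ> first_cyc i ?k"
    "hd (compose_all (rev ?L) (second_cyc i ?k)) = last ?L \<circ> second_cyc i ?k"
    using L(1) by (simp_all add: compose_all_def last_map hd_map hd_rev)
  moreover have "signed_step {1..?k} (last ?L \<circ> first_cyc i ?k) (last ?L \<circ> second_cyc i ?k)"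
  proof -
    have "last ?L \<in> signed_involutions (?N - {i})" using L(1,5) last_in_set by blast
    note w = signed_involutionsD[OF this]
    show ?thesis
      by (rule signed_step_swap_sign) (use i in \<open>auto intro!: w simp: mem_plus_minus\<close>)
  qed
  ultimately show "successively (signed_step {1..?k}) (swap_block r B i)"
    unfolding swap_block_def successively_append_iff
    using half[OF c(1)] by (simp only:) simp
qed

section \<open>Assembly of the three pieces of the list\<close>

theorem theorem3p4:
  fixes n :: nat
  assumes "n \<ge> 4"
    and "lists_involutions_once (n - 2) (GCB (n - 2))"
    and "property_A1 (n - 2) (GCB (n - 2))"
    and "property_A2 (n - 2) (GCB (n - 2))"
    and "lists_involutions_once (n - 1) (GCB (n - 1))"
    and "property_A1 (n - 1) (GCB (n - 1))"
    and "property_A2 (n - 1) (GCB (n - 1))"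
  shows "lists_involutions_once n (GCB n) \<and> property_A1 n (GCB n) \<and> property_A2 n (GCB n) \<and>
    cyclic_A2 n (GCB n)"
proof -
  define r where "r = n - 2"
  have n: "n = r + 2" "n - 2 = r" "n - 1 = r + 1" and r: "r \<ge> 2"
    using assms(1) by (simp_all add: r_def)
  define k where "k = int r + 2"
  have kn: "int n = k" "int r + 1 = k - 1" "int (r + 1) = k - 1" "int r + 2 = k"
    and k: "k \<ge> 4" using n r by (simp_all add: k_def)
  define A where "A = GCB (r + 1)"
  define A' where "A' = compose_all (rev A) (bar_cyc k)"
  define B where "B = swap_block r (GCB r)"
  define C where "C = concat (map B [1..k - 1])"
  have G: "GCB n = A @ A' @ C"
    using GCB_rec[OF r] by (simp add: n(1) A_def A'_def B_def C_def kn)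

  have setA: "set A = signed_involutions {1..k - 1}" and distA: "distinct A"
    and A: "A \<noteq> []" "hd A = id" and stepA: "successively (signed_step {1..k - 1}) A"
    using assms(5-7)
    unfolding lists_involutions_once_def property_A1_def property_A2_iff n(3) kn A_def[symmetric]
    by auto
  have N: "insert k {1..k - 1} = {1..k}" using k by auto
  have "set A = {v \<in> signed_involutions {1..k}. v k = k}"
    unfolding setA by (rule signed_involutions_fixing[of k "{1..k - 1}", unfolded N]) (use k in auto)
  moreover have "set A' = {v \<in> signed_involutions {1..k}. v k = - k}"
    unfolding A'_def compose_all_def set_map set_rev setA
    by (rule signed_involutions_negating[of k "{1..k - 1}", unfolded N]) (use k in auto)
  moreover have "distinct A'"
    using distA unfolding A'_def
    by (intro distinct_compose_all[OF _ bar_cyc_signed_involution]) simp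
  ultimately have AA': "set A = {v \<in> signed_involutions {1..k}. v k = k}"
    "set A' = {v \<in> signed_involutions {1..k}. v k = - k}" "distinct A'" .
  have lastA': "A' \<noteq> []" "last A' = bar_cyc k"
    using A by (simp_all add: A'_def compose_all_def last_map last_rev)
  have hdA': "hd A' = last A \<circ> bar_cyc k"
    using A by (simp add: A'_def compose_all_def hd_map hd_rev)

  note props = swap_block_props[of r "GCB r", folded B_def, unfolded kn]
  have B: "B i \<noteq> []" "hd (B i) = first_cyc i k" "last (B i) = second_cyc i k" "distinct (B i)"
    "set (B i) = {v \<in> signed_involutions {1..k}. v k = i \<or> v k = - i}"
    "successively (signed_step {1..k}) (B i)" if "1 \<le> i" "i \<le> k - 1" for i
    using props[of i] that assms(2-4) by (simp_all add: n property_A1_def)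
  have "[1..k - 1] = 1 # [1 + 1..k - 1]" using k by (intro upto_rec1) simp
  then have C: "C \<noteq> []" "hd C = first_cyc 1 k"
    using B(1,2)[of 1] k by (simp_all add: C_def)
  have "[1..k - 1] = [1..k - 1 - 1] @ [k - 1]" using k by (intro upto_rec2) simp
  then have lastC: "last C = second_cyc (k - 1) k"
    using B(1,3)[of "k - 1"] k by (simp add: C_def)

  have once: "lists_involutions_once n (GCB n)"
  proof -
    \<comment> \<open>The value \<open>v k\<close> separates the pieces: it is \<open>k\<close> on
      \<open>A\<close>, \<open>-k\<close> on \<open>A'\<close>, and of absolute value below
      \<open>k\<close> on \<open>C\<close>, where the absolute value names the block.\<close>
    have setC: "set C = {v \<in> signed_involutions {1..k}. \<bar>v k\<bar> \<in> {1..k - 1}}"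
      using B(5) by (force simp: C_def)
    have "distinct C" unfolding C_def
      by (rule distinct_concat_map) (use B(4,5) in auto)
    then have "distinct (GCB n)"
      using distA AA' k by (auto simp: G setC)
    \<comment> \<open>Completeness: no values of \<open>v k\<close> exist beyond those treated by
      the three pieces.\<close>
    moreover have "v k \<in> plus_minus {1..k}" if "v \<in> signed_involutions {1..k}" for v
      using signed_involutionsD(4)[OF that, of k] k by (simp add: mem_plus_minus)
    then have "set (GCB n) = signed_involutions {1..k}"
      unfolding G set_append AA' setC by (fastforce simp: mem_plus_minus)
    ultimately show ?thesis by (simp add: lists_involutions_once_def kn)
  qed

  have step: "successively (signed_step {1..k}) (GCB n)"
  proof -
    \<comment> \<open>Used with \<open>id\<close> for \<open>A\<close> and with
      \<open>bar_cyc k\<close> for \<open>A'\<close>, the latter then reversed.\<close>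
    have ext: "successively (signed_step {1..k}) (map (\<lambda>w. w \<circ> c) A)"
      if "c \<in> signed_involutions {k}" for c
      by (rule successively_map_lift[OF stepA])
        (use that k setA in \<open>auto intro: signed_step_extend\<close>)
    have "successively (signed_step {1..k}) A"
      using ext[OF id_signed_involution] by simp
    moreover have "successively (signed_step {1..k}) A'"
      using successively_rev_signed_step[OF ext[OF bar_cyc_signed_involution]]
      by (simp add: A'_def compose_all_def rev_map)
    \<comment> \<open>The seam between \<open>A\<close> and \<open>A'\<close>: the reversed list
      starts with the same involution, so only the sign at place \<open>k\<close> changes.\<close>
    moreover have "signed_step {1..k} (last A) (last A \<circ> bar_cyc k)"
    proof -
      have "last A \<in> signed_involutions {1..k - 1}" using A setA last_in_set by blast
      note w = signed_involutionsD[OF this]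
      show ?thesis
        by (rule signed_step_signs[of "{k}"])
          (use k in \<open>auto simp: bar_cyc_def transpose_def w(2)\<close>)
    qed
    moreover have "successively (signed_step {1..k}) C"
      unfolding C_def
    proof (rule successively_concat_map)
      show "successively (\<lambda>x y. signed_step {1..k} (last (B x)) (hd (B y))) [1..k - 1]"
        unfolding successively_conv_nth
      proof (intro allI impI)
        fix l assume "Suc l < length [1..k - 1]"
        \<comment> \<open>List index \<open>l\<close> stands for block \<open>1 + l\<close>, so the
          blocks that meet are \<open>1 + l\<close> and \<open>2 + l\<close>, the latter at most
          \<open>k - 1\<close>.\<close>
        then have l: "1 + int l + 1 \<le> k - 1" by simp
        then have nth: "[1..k - 1] ! l = 1 + int l" "[1..k - 1] ! Suc l = 1 + int l + 1"
          by (simp_all add: nth_upto)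
        show "signed_step {1..k} (last (B ([1..k - 1] ! l))) (hd (B ([1..k - 1] ! Suc l)))"
          unfolding nth using l B(3)[of "1 + int l"] B(2)[of "1 + int l + 1"]
            signed_step_next_block[of "1 + int l" k] by simp
      qed
    qed (use B in auto)
    \<comment> \<open>The seam between \<open>A'\<close> and \<open>C\<close>: \<open>A'\<close>
      ends with the pure cycle \<open>bar_cyc k\<close> because \<open>A\<close> starts with
      \<open>id\<close>.\<close>
    moreover have "signed_step {1..k} (bar_cyc k) (first_cyc 1 k)"
      using k by (intro signed_step_first_block) simp
    ultimately show ?thesis
      by (simp add: G successively_append_iff A C lastA' hdA')
  qed

  have ends: "GCB n \<noteq> []" "hd (GCB n) = id" "last (GCB n) = second_cyc (k - 1) k"
    using A C lastC by (simp_all add: G)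
  have "property_A1 n (GCB n)"
    using ends by (simp add: property_A1_def kn second_cyc_def)
  moreover have "property_A2 n (GCB n)"
    using step by (simp add: property_A2_iff kn)
  moreover have "cyclic_A2 n (GCB n)"
    using ends k signed_step_to_id[of "k - 1" k] by (simp add: cyclic_A2_def A2_step_one_line kn)
  ultimately show ?thesis using once by blast
qed

end
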